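(* Let $f:\mathbf{N}\to\mathbf{C}$ be a multiplicative function that is bounded in mean square, i.e., \[ \limsup_{x\to\infty} \frac{1}{x}\sum_{n \leq x}|f(n)|^2 < \infty. \] Suppose that for every nonnegative integer $k$, the function $n\mapsto f(n) \left(n/\sigma(n)\right)^k$ possesses a mean value. Then for every real $u \in [0,1]$, the limit \[ D_f(u):= \lim_{x\to\infty} \frac{1}{x}\sum_{\substack{n \leq x \\ n/\sigma(n)\leq u}} f(n) \] exists. Moreover, $D_f(u)$ is continuous as a function of $u$ on $[0,1]$.
   Context: $\sigma(n)=\sum_{d\mid n} d$ is the sum-of-divisors function. An arithmetic function $g$ is said to possess a mean value if $\frac{1}{x}\sum_{n\le x} g(n)$ tends to a finite complex limit as $x\to\infty$. *)

theory Defs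
  imports "HOL-Analysis.Analysis"
begin


definition divisor_sigma :: "nat \<Rightarrow> nat" where
  "divisor_sigma n = (\<Sum>d | d dvd n. d)"

text \<open>Arithmetic functions are modelled on \<open>nat\<close>; the value at \<open>0\<close> is never used.\<close>

definition multiplicative :: "(nat \<Rightarrow> complex) \<Rightarrow> bool" where
  "multiplicative f \<longleftrightarrow> f 1 = 1 \<and>
     (\<forall>m n. m > 0 \<longrightarrow> n > 0 \<longrightarrow> coprime m n \<longrightarrow> f (m * n) = f m * f n)"

definition bounded_in_mean_square :: "(nat \<Rightarrow> complex) \<Rightarrow> bool" where
  "bounded_in_mean_square f \<longleftrightarrow>
     Limsup at_top (\<lambda>x::real. ereal ((1 / x) * (\<Sum>n | 1 \<le> n \<and> real n \<le> x. (cmod (f n))\<^sup>2))) < \<infinity>"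

definition has_mean_value :: "(nat \<Rightarrow> complex) \<Rightarrow> bool" where
  "has_mean_value g \<longleftrightarrow>
     (\<exists>L. ((\<lambda>x::real. complex_of_real (1 / x) * (\<Sum>n | 1 \<le> n \<and> real n \<le> x. g n)) \<longlongrightarrow> L) at_top)"

definition D_mean :: "(nat \<Rightarrow> complex) \<Rightarrow> real \<Rightarrow> real \<Rightarrow> complex" where
  "D_mean f u x = complex_of_real (1 / x) *
     (\<Sum>n | 1 \<le> n \<and> real n \<le> x \<and> real n / real (divisor_sigma n) \<le> u. f n)"

text \<open>Only meaningful when the limit exists; \<open>Lim\<close> is a definite description.\<close>

definition D :: "(nat \<Rightarrow> complex) \<Rightarrow> real \<Rightarrow> complex" where
  "D f u = Lim at_top (D_mean f u)"

end

theory Submission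
  imports Defs
begin

text \<open>
  By Weierstrass approximation, the moment hypothesis shows that \<open>f(n) g(n/\<sigma>(n))\<close> has a mean value
  for every continuous \<open>g\<close>. Replacing the indicator function of \<open>t \<le> u\<close> by a continuous \<open>g\<close> costs at most the mean of
  \<open>|f(n)|\<close> over the \<open>n\<close> with \<open>n/\<sigma>(n)\<close> near \<open>u\<close>; as \<open>f\<close> is bounded in mean square, this is small as soon as these \<open>n\<close>
  have small upper density.

  That density is bounded as follows. Let \<open>G(n) = g(n/\<sigma>(n))\<close> with \<open>g\<close> a narrow bump at \<open>u > 0\<close>. Truncating
  \<open>\<sigma>(n)/n = \<Sum> 1/d\<close> to \<open>d \<le> Y\<close> approximates \<open>G\<close> in mean by periodic functions, so \<open>G\<close> has a mean value \<open>d\<close>.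
  Dividing \<open>m\<close> by a prime \<open>p\<close> that divides it exactly once multiplies \<open>m/\<sigma>(m)\<close> by \<open>1 + 1/p\<close>. These factors are distinct, so for
  a narrow bump at most one such \<open>p \<le> B\<close> has \<open>G(m/p) \<noteq> 0\<close>. Averaging over \<open>m\<close> gives
  \<open>\<Sum> (1/p) (d - 1/p) \<le> 1\<close>, summed over the primes \<open>p \<le> B\<close>, and \<open>d\<close> is small because \<open>\<Sum> 1/p\<close> diverges.
  At \<open>u = 0\<close> the bounded mean of \<open>\<sigma>(n)/n\<close> suffices.
\<close>

section \<open>Averages over the integers up to x\<close>

definition nats_upto :: "real \<Rightarrow> nat set" where
  "nats_upto x = {n. 1 \<le> n \<and> real n \<le> x}"

text \<open>Values lie in any real normed space, so that the complex means of \<open>f\<close> and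
  the real majorants bounding them share one set of lemmas.\<close>

definition avg :: "(nat \<Rightarrow> 'a::real_normed_vector) \<Rightarrow> real \<Rightarrow> 'a" where
  "avg g x = (1 / x) *\<^sub>R (\<Sum>n\<in>nats_upto x. g n)"

definition sigma_ratio :: "nat \<Rightarrow> real" where
  "sigma_ratio n = real n / real (divisor_sigma n)"

lemma nats_upto_eq: "nats_upto x = {1..nat \<lfloor>x\<rfloor>}"
  unfolding nats_upto_def by (auto simp: le_nat_floor) linarith

lemma finite_nats_upto [simp, intro]: "finite (nats_upto x)"
  by (simp add: nats_upto_eq)

lemma card_nats_upto_le: "x \<ge> 0 \<Longrightarrow> real (card (nats_upto x)) \<le> x"
  by (simp add: nats_upto_eq)

lemma avg_add: "avg (\<lambda>n. f n + g n) x = avg f x + avg g x"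
  by (simp add: avg_def sum.distrib scaleR_add_right)

lemma avg_diff: "avg (\<lambda>n. f n - g n) x = avg f x - avg g x"
  by (simp add: avg_def sum_subtractf scaleR_diff_right)

lemma avg_cmult: "avg (\<lambda>n. c * f n :: real) x = c * avg f x"
  by (simp add: avg_def sum_distrib_left mult_ac)

lemma avg_mono:
  fixes f g :: "nat \<Rightarrow> real"
  assumes "x > 0" "\<And>n. n \<ge> 1 \<Longrightarrow> f n \<le> g n"
  shows "avg f x \<le> avg g x"
  unfolding avg_def using assms
  by (auto intro!: divide_right_mono sum_mono simp: nats_upto_def)

lemma norm_avg_le:
  assumes "x > 0"
  shows "norm (avg f x) \<le> avg (\<lambda>n. norm (f n)) x"
  unfolding avg_def using assms by (auto intro!: divide_right_mono norm_sum)

lemma avg_const_le: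
  assumes "x > 0" "c \<ge> 0"
  shows "avg (\<lambda>_. c :: real) x \<le> c"
  using card_nats_upto_le[of x] assms mult_right_mono[of "real (card (nats_upto x))" x c]
  by (simp add: avg_def field_simps)

text \<open>Eventually F stays within \<open>e\<close> of G and G within \<open>e\<close> of its
  limit, so F satisfies the Cauchy condition and completeness supplies a limit. This serves three
  approximations: by periodic functions, by polynomials, and of an indicator by continuous
  functions.\<close>

lemma tendsto_exists_approx:
  fixes F :: "real \<Rightarrow> 'a::banach"
  assumes "\<And>e. e > 0 \<Longrightarrow> \<exists>G L. (G \<longlongrightarrow> L) at_top \<and> (\<forall>\<^sub>F x in at_top. norm (F x - G x) \<le> e)"
  shows "\<exists>L. (F \<longlongrightarrow> L) at_top"
proof -
  have "cauchy_filter (filtermap F at_top)"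
    unfolding cauchy_filter_metric_filtermap
  proof safe
    fix e :: real assume e: "e > 0"
    then obtain G L where G: "(G \<longlongrightarrow> L) at_top" "\<forall>\<^sub>F x in at_top. norm (F x - G x) \<le> e / 4"
      using assms[of "e/4"] by auto
    have ev: "\<forall>\<^sub>F x in at_top. dist (F x) L < e / 2"
      using G(2) tendstoD[OF G(1), of "e / 4", simplified, OF e]
    proof eventually_elim
      case (elim x)
      have "dist (F x) L \<le> dist (F x) (G x) + dist (G x) L" by (rule dist_triangle)
      with elim show ?case by (simp add: dist_norm)
    qed
    show "\<exists>P. eventually P at_top \<and> (\<forall>x y. P x \<and> P y \<longrightarrow> dist (F x) (F y) < e)"
      by (rule exI[of _ "\<lambda>x. dist (F x) L < e / 2"]) (use ev in \<open>auto intro: dist_triangle_half_l[of _ L] simp: dist_commute\<close>)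
  qed
  then have "\<exists>L\<in>UNIV. filtermap F at_top \<le> nhds L"
    using complete_UNIV[where 'a='a] unfolding complete_uniform
    by (simp add: filtermap_bot_iff)
  then show ?thesis by (simp add: filterlim_def)
qed

section \<open>Multiples, reciprocal divisor sums and their truncation\<close>

lemma sum_multiples_nats_upto:
  assumes "d > 0"
  shows "(\<Sum>m\<in>{m\<in>nats_upto x. d dvd m}. g m) = (\<Sum>n\<in>nats_upto (x / real d). g (d * n))"
proof (rule sum.reindex_bij_witness[of _ "\<lambda>n. d * n" "\<lambda>m. m div d"])
  fix m assume "m \<in> {m \<in> nats_upto x. d dvd m}"
  moreover from this obtain k where "m = d * k" by blast
  ultimately show "m div d \<in> nats_upto (x / real d)" "g (d * (m div d)) = g m"
    using assms by (auto simp: nats_upto_def field_simps Suc_le_eq)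
qed (use assms in \<open>auto simp: nats_upto_def field_simps Suc_le_eq\<close>)

lemma card_multiples_nats_upto_le:
  assumes "d > 0" "x \<ge> 0"
  shows "real (card {m\<in>nats_upto x. d dvd m}) \<le> x / real d"
  using sum_multiples_nats_upto[OF assms(1), of "\<lambda>_. 1::real" x] card_nats_upto_le[of "x / real d"] assms
  by simp

text \<open>Telescoping: 1/d^2 is at most 1/(d-1) - 1/d.\<close>

lemma sum_inverse_squares_le:
  assumes "Y \<ge> 1"
  shows "(\<Sum>d\<in>{Y<..M}. 1 / (real d)\<^sup>2) \<le> 1 / real Y"
proof -
  have "(\<Sum>d\<in>{Y<..M}. 1 / (real d)\<^sup>2) \<le> 1 / real Y - 1 / real M" if "Y \<le> M"
    using that
  proof (induction M rule: dec_induct)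
    case (step M)
    have "{Y<..Suc M} = insert (Suc M) {Y<..M}" using step by auto
    moreover have "1 / (real (Suc M))\<^sup>2 \<le> 1 / real M - 1 / real (Suc M)"
    proof -
      have "real M > 0" using step assms by simp
      then have "1 / (real (Suc M))\<^sup>2 \<le> 1 / (real M * real (Suc M))"
        by (intro divide_left_mono) (auto simp: power2_eq_square intro!: mult_right_mono)
      also have "\<dots> = 1 / real M - 1 / real (Suc M)"
        using \<open>real M > 0\<close> by (simp add: field_simps)
      finally show ?thesis .
    qed
    ultimately show ?case using step by simp
  qed simp
  then show ?thesis by (cases "Y \<le> M") (auto intro: order.trans)
qed

lemma sigma_eq_sum_inverse:
  assumes "n > 0"
  shows "real (divisor_sigma n) / real n = (\<Sum>d | d dvd n. 1 / real d)"
proof -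
  have "(\<Sum>d | d dvd n. real d / real n) = (\<Sum>d | d dvd n. 1 / real d)"
    by (rule sum.reindex_bij_witness[of _ "\<lambda>d. n div d" "\<lambda>d. n div d"])
       (use assms in \<open>auto simp: real_of_nat_div div_div_eq_right\<close>)
  then show ?thesis by (simp add: divisor_sigma_def sum_divide_distrib)
qed

text \<open>The condition \<open>1 \<le> d\<close> keeps out d = 0, which divides n = 0; the index
  set itself is then periodic in n, also at 0.\<close>

definition sigma_trunc :: "nat \<Rightarrow> nat \<Rightarrow> real" where
  "sigma_trunc Y n = (\<Sum>d | d dvd n \<and> d \<le> Y \<and> 1 \<le> d. 1 / real d)"

lemma sigma_trunc_ge_1: "Y \<ge> 1 \<Longrightarrow> sigma_trunc Y n \<ge> 1"
  using member_le_sum[of 1 "{d. d dvd n \<and> d \<le> Y \<and> 1 \<le> d}" "\<lambda>d. 1 / real d"]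
  by (simp add: sigma_trunc_def)

lemma sigma_minus_trunc:
  assumes "n > 0"
  shows "real (divisor_sigma n) / real n - sigma_trunc Y n = (\<Sum>d | d dvd n \<and> Y < d. 1 / real d)"
proof -
  have "(\<Sum>d | d dvd n. 1 / real d)
      = (\<Sum>d\<in>{d. d dvd n \<and> d \<le> Y \<and> 1 \<le> d} \<union> {d. d dvd n \<and> Y < d}. 1 / real d)"
    using dvd_pos_nat[OF assms] by (intro sum.cong refl) (auto simp: Suc_le_eq)
  also have "\<dots> = sigma_trunc Y n + (\<Sum>d | d dvd n \<and> Y < d. 1 / real d)"
    unfolding sigma_trunc_def using assms finite_divisors_nat[of n]
    by (intro sum.union_disjoint) auto
  finally have "(\<Sum>d | d dvd n. 1 / real d) = sigma_trunc Y n + (\<Sum>d | d dvd n \<and> Y < d. 1 / real d)" .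
  then show ?thesis using sigma_eq_sum_inverse[OF assms] by simp
qed

text \<open>After exchanging the sums, each d divides at most x/d of the n up to x and contributes
  1/d for each of them. The total is at most x times the tail of the sum of 1/d^2.\<close>

lemma avg_large_divisors_le:
  assumes "Y \<ge> 1" "x > 0"
  shows "avg (\<lambda>n. \<Sum>d | d dvd n \<and> Y < d. 1 / real d) x \<le> 1 / real Y"
proof -
  define M where "M = nat \<lfloor>x\<rfloor>"
  have "(\<Sum>n\<in>nats_upto x. \<Sum>d | d dvd n \<and> Y < d. 1 / real d)
      = (\<Sum>n\<in>nats_upto x. \<Sum>d\<in>{d\<in>{Y<..M}. d dvd n}. 1 / real d)"
    by (intro sum.cong refl) (auto simp: nats_upto_eq M_def dest: dvd_imp_le)
  also have "\<dots> = (\<Sum>d\<in>{Y<..M}. \<Sum>n\<in>{n\<in>nats_upto x. d dvd n}. 1 / real d)"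
    by (rule sum.swap_restrict) auto
  also have "\<dots> \<le> (\<Sum>d\<in>{Y<..M}. x * (1 / (real d)\<^sup>2))"
  proof (rule sum_mono)
    fix d assume "d \<in> {Y<..M}"
    then show "(\<Sum>n\<in>{n\<in>nats_upto x. d dvd n}. 1 / real d) \<le> x * (1 / (real d)\<^sup>2)"
      using card_multiples_nats_upto_le[of d x] assms
      by (simp add: power2_eq_square field_simps)
  qed
  also have "\<dots> \<le> x * (1 / real Y)"
    unfolding sum_distrib_left[symmetric]
    using sum_inverse_squares_le[OF assms(1)] assms(2) by (intro mult_left_mono) auto
  finally show ?thesis using assms(2) by (simp add: avg_def field_simps)
qed

text \<open>The divisor 1 contributes 1, and all larger divisors together at most 1 in mean.\<close>

lemma avg_sigma_le:
  assumes "x > 0"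
  shows "avg (\<lambda>n. real (divisor_sigma n) / real n) x \<le> 2"
proof -
  have "avg (\<lambda>n. real (divisor_sigma n) / real n) x
      \<le> avg (\<lambda>n. 1 + (\<Sum>d | d dvd n \<and> 1 < d. 1 / real d)) x"
  proof (rule avg_mono[OF assms])
    fix n :: nat assume "n \<ge> 1"
    moreover have "{d. d dvd n \<and> d \<le> 1 \<and> 1 \<le> d} = {1}" by auto
    ultimately show "real (divisor_sigma n) / real n \<le> 1 + (\<Sum>d | d dvd n \<and> 1 < d. 1 / real d)"
      using sigma_minus_trunc[of n 1] by (simp add: sigma_trunc_def)
  qed
  also have "\<dots> \<le> 1 + 1"
    unfolding avg_add using avg_const_le[OF assms, of 1] avg_large_divisors_le[of 1, OF _ assms]
    by (intro add_mono) auto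
  finally show ?thesis by simp
qed

lemma sigma_ratio_eq: "sigma_ratio n = inverse (real (divisor_sigma n) / real n)"
  by (simp add: sigma_ratio_def)

lemma divisor_sigma_ge: "n > 0 \<Longrightarrow> divisor_sigma n \<ge> n"
  unfolding divisor_sigma_def using member_le_sum[of n "{d. d dvd n}" "\<lambda>d. d"] finite_divisors_nat[of n]
  by auto

lemma sigma_ratio_bounds:
  assumes "n > 0"
  shows "0 < sigma_ratio n" "sigma_ratio n \<le> 1"
  using divisor_sigma_ge[OF assms] assms by (auto simp: sigma_ratio_def)

text \<open>Both sigma(n)/n and its truncation are at least 1, and inversion does not increase
  distances there; their difference is the tail over divisors beyond \<open>Y\<close>.\<close>

lemma sigma_ratio_approx:
  assumes "n > 0" "Y \<ge> 1"
  shows "\<bar>sigma_ratio n - inverse (sigma_trunc Y n)\<bar> \<le> (\<Sum>d | d dvd n \<and> Y < d. 1 / real d)"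
proof -
  define a where "a = real (divisor_sigma n) / real n"
  define b where "b = sigma_trunc Y n"
  have b: "b \<ge> 1" unfolding b_def by (rule sigma_trunc_ge_1[OF assms(2)])
  have ab: "a - b = (\<Sum>d | d dvd n \<and> Y < d. 1 / real d)"
    unfolding a_def b_def by (rule sigma_minus_trunc[OF assms(1)])
  then have "a \<ge> b" using sum_nonneg[of "{d. d dvd n \<and> Y < d}" "\<lambda>d. 1 / real d"] by simp
  have "\<bar>inverse a - inverse b\<bar> = (a - b) / (a * b)"
    using \<open>a \<ge> b\<close> b by (simp add: field_simps abs_if)
  also have "\<dots> \<le> (a - b) / 1"
    using \<open>a \<ge> b\<close> b mult_mono[of 1 a 1 b] by (intro divide_left_mono) auto
  finally show ?thesis using ab unfolding sigma_ratio_eq a_def b_def by simp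
qed

section \<open>Mean values of periodic functions and of Lipschitz functions of n/sigma(n)\<close>

lemma sigma_trunc_periodic: "sigma_trunc Y (n + fact Y) = sigma_trunc Y n"
proof -
  have "d dvd n + fact Y \<longleftrightarrow> d dvd n" if "d \<le> Y" "1 \<le> d" for d
    using dvd_fact[OF that(2,1)] by (simp add: dvd_add_left_iff)
  then show ?thesis unfolding sigma_trunc_def by (intro sum.cong) auto
qed

text \<open>With \<open>c\<close> the mean over one period, the deviation \<open>E\<close> of the
  partial sums from the line of slope \<open>c\<close> is itself periodic, hence bounded. The
  average therefore differs from \<open>c\<close> by O(1/x).\<close>

lemma avg_periodic_tendsto:
  fixes g :: "nat \<Rightarrow> real"
  assumes "T > 0" and per: "\<And>n. g (n + T) = g n"
  shows "\<exists>L. (avg g \<longlongrightarrow> L) at_top"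
proof -
  define S where "S N = (\<Sum>n\<in>{1..N}. g n)" for N :: nat
  define c where "c = S T / real T"
  define E where "E N = S N - c * real N" for N
  have S: "S (N + T) = S N + S T" for N
  proof (induction N)
    case (Suc N)
    then show ?case using per[of "Suc N"] by (simp add: S_def)
  qed (simp add: S_def)
  have E_per: "E (N + T) = E N" for N
    using \<open>T > 0\<close> by (simp add: E_def S c_def field_simps)
  have E_mult: "E (N + k * T) = E N" for N k
  proof (induction k)
    case (Suc k)
    then show ?case using E_per[of "N + k * T"] by (simp add: add_ac)
  qed simp
  have E_mod: "E N = E (N mod T)" for N
    using E_mult[of "N mod T" "N div T"] by simp
  define B where "B = (\<Sum>N<T. \<bar>E N\<bar>)"
  have E_bd: "\<bar>E N\<bar> \<le> B" for N
    unfolding B_def E_mod[of N] using \<open>T > 0\<close>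
    by (intro member_le_sum[of "N mod T" "{..<T}" "\<lambda>N. \<bar>E N\<bar>"]) auto
  have "((\<lambda>x. avg g x - c) \<longlongrightarrow> 0) at_top"
  proof (rule Lim_null_comparison)
    show "((\<lambda>x. (B + \<bar>c\<bar>) / x) \<longlongrightarrow> 0) at_top"
      by (intro tendsto_divide_0[OF tendsto_const] filterlim_at_top_imp_at_infinity filterlim_ident)
    show "\<forall>\<^sub>F x in at_top. norm (avg g x - c) \<le> (B + \<bar>c\<bar>) / x"
      using eventually_gt_at_top[of 0]
    proof eventually_elim
      case (elim x)
      define N where "N = nat \<lfloor>x\<rfloor>"
      \<comment> \<open>Rounding x down to \<open>N\<close> costs at most the slope, which is the
        second term of the numerator \<open>B + \<bar>c\<bar>\<close>.\<close>
      have "\<bar>real N - x\<bar> \<le> 1" unfolding N_def using elim by linarith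
      then have "\<bar>c * (real N - x)\<bar> \<le> \<bar>c\<bar>" by (simp add: abs_mult mult_left_le)
      have "avg g x - c = (E N + c * (real N - x)) / x"
        using elim by (simp add: avg_def nats_upto_eq E_def S_def N_def field_simps)
      moreover have "\<bar>E N + c * (real N - x)\<bar> \<le> B + \<bar>c\<bar>"
        using E_bd[of N] \<open>\<bar>c * (real N - x)\<bar> \<le> \<bar>c\<bar>\<close> by linarith
      ultimately show ?case using elim by (simp add: divide_right_mono)
    qed
  qed
  then show ?thesis using LIM_zero_cancel by blast
qed

text \<open>Replacing sigma(n)/n by its truncation at \<open>Y\<close> makes the function periodic
  with period \<open>fact Y\<close>. The error at n is at most K times the sum of 1/d over divisors
  beyond \<open>Y\<close>, so at most K/Y in mean.\<close>

lemma avg_lipschitz_sigma_ratio_tendsto: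
  fixes g :: "real \<Rightarrow> real"
  assumes lip: "\<And>s t. \<bar>g s - g t\<bar> \<le> K * \<bar>s - t\<bar>"
  shows "\<exists>L. (avg (\<lambda>n. g (sigma_ratio n)) \<longlongrightarrow> L) at_top"
proof (rule tendsto_exists_approx)
  fix e :: real assume e: "e > 0"
  have K: "K \<ge> 0" using lip[of 0 1] by simp
  obtain Y :: nat where Y: "K / e < real Y" using reals_Archimedean2 by blast
  have "Y \<ge> 1" using Y K e by (cases Y) (auto simp: divide_less_0_iff)
  define G where "G n = g (inverse (sigma_trunc Y n))" for n
  obtain L where L: "(avg G \<longlongrightarrow> L) at_top"
    using avg_periodic_tendsto[of "fact Y" G] sigma_trunc_periodic by (auto simp: G_def)
  have "\<forall>\<^sub>F x in at_top. norm (avg (\<lambda>n. g (sigma_ratio n)) x - avg G x) \<le> e"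
    using eventually_gt_at_top[of 0]
  proof eventually_elim
    case (elim x)
    have "norm (avg (\<lambda>n. g (sigma_ratio n)) x - avg G x) \<le> avg (\<lambda>n. norm (g (sigma_ratio n) - G n)) x"
      unfolding avg_diff[symmetric] by (rule norm_avg_le[OF elim])
    also have "\<dots> \<le> avg (\<lambda>n. K * (\<Sum>d | d dvd n \<and> Y < d. 1 / real d)) x"
    proof (rule avg_mono[OF elim])
      fix n :: nat assume "n \<ge> 1"
      then have "K * \<bar>sigma_ratio n - inverse (sigma_trunc Y n)\<bar> \<le> K * (\<Sum>d | d dvd n \<and> Y < d. 1 / real d)"
        using sigma_ratio_approx[of n Y] \<open>Y \<ge> 1\<close> K by (intro mult_left_mono) auto
      then show "norm (g (sigma_ratio n) - G n) \<le> K * (\<Sum>d | d dvd n \<and> Y < d. 1 / real d)"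
        using lip[of "sigma_ratio n" "inverse (sigma_trunc Y n)"] by (simp add: G_def)
    qed
    also have "\<dots> \<le> K * (1 / real Y)"
      unfolding avg_cmult using avg_large_divisors_le[OF \<open>Y \<ge> 1\<close> elim] K by (intro mult_left_mono) auto
    also have "\<dots> \<le> e" using Y e \<open>Y \<ge> 1\<close> by (simp add: field_simps)
    finally show ?case .
  qed
  with L show "\<exists>G L. (G \<longlongrightarrow> L) at_top \<and> (\<forall>\<^sub>F x in at_top. norm (avg (\<lambda>n. g (sigma_ratio n)) x - G x) \<le> e)"
    by blast
qed

section \<open>Primes: their effect on n/sigma(n) and the divergence of their reciprocals\<close>

lemma divisor_sigma_prime_mult:
  assumes "prime p" "\<not> p dvd n" "n > 0"
  shows "divisor_sigma (p * n) = (p + 1) * divisor_sigma n"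
proof -
  have p: "p > 0" using assms(1) by (rule prime_gt_0_nat)
  have cop: "coprime p n" using assms prime_imp_coprime by blast
  have "d dvd n \<or> (\<exists>k. d = p * k \<and> k dvd n)" if "d dvd p * n" for d
  proof (cases "p dvd d")
    case True
    then obtain k where "d = p * k" by blast
    then show ?thesis using that p by auto
  next
    case False
    then have "coprime d p" using assms(1) prime_imp_coprime coprime_commute by blast
    then show ?thesis using that coprime_dvd_mult_right_iff by blast
  qed
  then have "{d. d dvd p * n} = {d. d dvd n} \<union> (\<lambda>d. p * d) ` {d. d dvd n}"
    by auto
  moreover have "{d. d dvd n} \<inter> (\<lambda>d. p * d) ` {d. d dvd n} = {}"
    using assms(2) by (auto dest: dvd_mult_left)
  moreover have "inj_on (\<lambda>d. p * d) {d. d dvd n}" using p by (auto intro: inj_onI)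
  ultimately show ?thesis
    unfolding divisor_sigma_def using finite_divisors_nat[OF assms(3)]
    by (simp add: sum.union_disjoint sum.reindex sum_distrib_left[symmetric])
qed

lemma sigma_ratio_prime_mult:
  assumes "prime p" "\<not> p dvd n" "n > 0"
  shows "sigma_ratio n = sigma_ratio (p * n) * (1 + 1 / real p)"
proof -
  have "real p > 0" "real (divisor_sigma n) > 0"
    using prime_gt_0_nat[OF assms(1)] divisor_sigma_ge[OF assms(3)] assms(3) by auto
  then have "sigma_ratio (p * n) = sigma_ratio n * (real p / (1 + real p))"
    unfolding sigma_ratio_def divisor_sigma_prime_mult[OF assms] by (simp add: algebra_simps)
  moreover have "(real p / (1 + real p)) * (1 + 1 / real p) = 1"
    using \<open>real p > 0\<close> by (simp add: divide_simps)
  ultimately show ?thesis by (simp only: mult.assoc mult_1_right)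
qed

text \<open>The smooth numbers over \<open>P \<union> {p}\<close> are those over \<open>P\<close> together with \<open>p\<close> times the smooth numbers
  over \<open>P \<union> {p}\<close>; solving the resulting inequality replaces the Euler product.\<close>

lemma sum_smooth_le_exp:
  assumes "finite P" "\<And>p. p \<in> P \<Longrightarrow> prime p"
  shows "(\<Sum>n | 1 \<le> n \<and> n \<le> N \<and> prime_factors n \<subseteq> P. 1 / real n) \<le> exp (2 * (\<Sum>p\<in>P. 1 / real p))"
  using assms
proof (induction P rule: finite_induct)
  case empty
  have "{n. 1 \<le> n \<and> n \<le> N \<and> prime_factors n \<subseteq> {}} \<subseteq> {1}"
    by (auto simp: prime_factorization_empty_iff)
  then have "(\<Sum>n | 1 \<le> n \<and> n \<le> N \<and> prime_factors n \<subseteq> {}. 1 / real n) \<le> (\<Sum>n\<in>{1::nat}. 1 / real n)"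
    by (intro sum_mono2) auto
  then show ?case by simp
next
  case (insert p P)
  define A where "A Q = {n. 1 \<le> n \<and> n \<le> N \<and> prime_factors n \<subseteq> Q}" for Q
  define T where "T Q = (\<Sum>n\<in>A Q. 1 / real n)" for Q
  have fin: "finite (A Q)" for Q by (rule finite_subset[of _ "{..N}"]) (auto simp: A_def)
  have p: "prime p" "real p \<ge> 2" using insert.prems[of p] prime_ge_2_nat[of p] by auto
  have "A (insert p P) \<subseteq> A P \<union> (\<lambda>m. p * m) ` A (insert p P)"
  proof
    fix n assume n: "n \<in> A (insert p P)"
    show "n \<in> A P \<union> (\<lambda>m. p * m) ` A (insert p P)"
    proof (cases "p dvd n")
      case True
      then obtain m where m: "n = p * m" by blast
      moreover have "m \<ge> 1" using n m by (cases m) (auto simp: A_def)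
      moreover have "prime_factors m \<subseteq> prime_factors n"
        using n m by (intro dvd_prime_factors) (auto simp: A_def)
      moreover have "m \<le> N" using n m p order.trans[of m "p * m" N] by (simp add: A_def)
      ultimately have "m \<in> A (insert p P)" using n unfolding A_def by auto
      then show ?thesis using m by blast
    next
      case False
      then show ?thesis using n by (auto simp: A_def in_prime_factors_iff)
    qed
  qed
  then have "T (insert p P) \<le> (\<Sum>n\<in>A P \<union> (\<lambda>m. p * m) ` A (insert p P). 1 / real n)"
    unfolding T_def by (intro sum_mono2) (auto simp: fin)
  also have "\<dots> \<le> T P + (\<Sum>n\<in>(\<lambda>m. p * m) ` A (insert p P). 1 / real n)"
    unfolding T_def by (subst sum.union_inter[symmetric]) (auto simp: fin intro!: sum_nonneg)
  also have "(\<Sum>n\<in>(\<lambda>m. p * m) ` A (insert p P). 1 / real n) = T (insert p P) / real p"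
    unfolding T_def using p by (subst sum.reindex) (auto intro!: inj_onI simp: sum_divide_distrib mult.commute)
  finally have "T (insert p P) * (1 - 1 / real p) \<le> T P" by (simp add: algebra_simps)
  \<comment> \<open>The product is 1 + 1/p - 2/p^2, at least 1 precisely because p is at least 2. So
    1 + 2/p, which the exponential dominates, can stand in for 1/(1 - 1/p).\<close>
  moreover have "T (insert p P) \<le> T (insert p P) * ((1 - 1 / real p) * (1 + 2 / real p))"
  proof -
    have "1 \<le> (1 - 1 / real p) * (1 + 2 / real p)" using p by (simp add: field_simps)
    moreover have "T (insert p P) \<ge> 0" unfolding T_def by (intro sum_nonneg) auto
    ultimately show ?thesis by (simp add: mult_le_cancel_left1)
  qed
  ultimately have "T (insert p P) \<le> T P * (1 + 2 / real p)"
    using p mult_right_mono[of "T (insert p P) * (1 - 1 / real p)" "T P" "1 + 2 / real p"]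
    by (simp add: mult.assoc)
  also have "\<dots> \<le> exp (2 * (\<Sum>p\<in>P. 1 / real p)) * exp (2 / real p)"
    using insert p exp_ge_add_one_self[of "2 / real p"]
    by (intro mult_mono) (auto simp: T_def A_def)
  also have "\<dots> = exp (2 * (\<Sum>p\<in>insert p P. 1 / real p))"
    using insert by (simp add: exp_add[symmetric] algebra_simps)
  finally show ?case unfolding T_def A_def .
qed

text \<open>All prime factors of an n up to \<open>B\<close> are at most \<open>B\<close>, so the
  harmonic sum up to \<open>B\<close> is one of the smooth sums just bounded; its divergence forces
  that of the exponent.\<close>

lemma prime_reciprocals_unbounded: "\<exists>B. (\<Sum>p | prime p \<and> p \<le> B. 1 / real p) > C"
proof -
  obtain B where B: "harm B > exp (2 * C)"
    using eventually_happens[OF filterlim_at_top_dense[THEN iffD1, OF harm_at_top, rule_format, of "exp (2 * C)"]]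
    by auto
  have "harm B = (\<Sum>n | 1 \<le> n \<and> n \<le> B \<and> prime_factors n \<subseteq> {p. prime p \<and> p \<le> B}. 1 / real n)"
    unfolding harm_def
    by (intro sum.cong) (auto simp: in_prime_factors_iff inverse_eq_divide dest!: dvd_imp_le)
  also have "\<dots> \<le> exp (2 * (\<Sum>p | prime p \<and> p \<le> B. 1 / real p))"
    by (rule sum_smooth_le_exp) auto
  finally have "exp (2 * C) < exp (2 * (\<Sum>p | prime p \<and> p \<le> B. 1 / real p))" using B by linarith
  then show ?thesis by auto
qed

section \<open>Concentration of n/sigma(n) near a point\<close>

text \<open>With s the ratio at m, the ratios at k and l are s(1 + 1/p) and s(1 + 1/q). Both lie
  within \<open>2 * e\<close> of u, so they differ by less than \<open>4 * e\<close>. For distinct p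
  and q, however, s is at least u/4 and 1/p, 1/q are at least 1/B^2 apart, a gap of at least u/(4
  B^2); the constant 16 makes this exactly \<open>4 * e\<close>.\<close>

lemma prime_shifts_disjoint:
  assumes u: "0 < u" and B: "B \<ge> 1" and e: "e = u / (16 * (real B)\<^sup>2)"
    and p: "prime p" "p \<le> B" "p * k = m" "\<not> p dvd k" "\<bar>sigma_ratio k - u\<bar> < 2 * e"
    and q: "prime q" "q \<le> B" "q * l = m" "\<not> q dvd l" "\<bar>sigma_ratio l - u\<bar> < 2 * e"
    and "m > 0"
  shows "p = q"
proof (rule ccontr)
  assume "p \<noteq> q"
  define s where "s = sigma_ratio m"
  have pos: "real p > 0" "real q > 0" "p > 0" "q > 0" using p q prime_gt_0_nat by auto
  have kl: "k > 0" "l > 0" using \<open>m > 0\<close> p q by (auto intro!: Nat.gr0I)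
  have s1: "sigma_ratio k = s * (1 + 1 / real p)"
    using sigma_ratio_prime_mult[of p k] p kl by (simp add: s_def)
  have s2: "sigma_ratio l = s * (1 + 1 / real q)"
    using sigma_ratio_prime_mult[of q l] q kl by (simp add: s_def)
  have s0: "s > 0" unfolding s_def by (rule sigma_ratio_bounds(1)[OF \<open>m > 0\<close>])
  have "(real B)\<^sup>2 \<ge> 1" using B by simp
  \<comment> \<open>The window around u is thus at most u/8 wide on each side, which keeps the ratio
    at k above u/2; since 1 + 1/p is at most 2, s is at least u/4.\<close>
  then have "e * 16 \<le> u" unfolding e using u B divide_left_mono[of 1 "(real B)\<^sup>2" u] by simp
  then have "sigma_ratio k \<ge> u / 2" using p(5) u by linarith
  moreover have "sigma_ratio k \<le> s * 2"
    unfolding s1 using s0 pos by (intro mult_left_mono) auto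
  ultimately have s4: "s \<ge> u / 4" by linarith
  have "1 \<le> \<bar>real q - real p\<bar>" using \<open>p \<noteq> q\<close> by linarith
  have "1 / (real B)\<^sup>2 \<le> 1 / (real p * real q)"
    unfolding power2_eq_square using p q pos by (intro divide_left_mono mult_mono) auto
  also have "\<dots> \<le> \<bar>real q - real p\<bar> / (real p * real q)"
    using \<open>1 \<le> \<bar>real q - real p\<bar>\<close> pos by (intro divide_right_mono) auto
  also have "\<dots> = \<bar>(real q - real p) / (real p * real q)\<bar>"
    by (simp add: abs_mult)
  also have "(real q - real p) / (real p * real q) = 1 / real p - 1 / real q"
    using pos by (simp add: field_simps)
  finally have d: "1 / (real B)\<^sup>2 \<le> \<bar>1 / real p - 1 / real q\<bar>" .
  have "4 * e = u / 4 * (1 / (real B)\<^sup>2)" by (simp add: e)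
  also have "\<dots> \<le> s * \<bar>1 / real p - 1 / real q\<bar>"
    using d s4 s0 by (intro mult_mono) auto
  also have "\<dots> = \<bar>sigma_ratio k - sigma_ratio l\<bar>"
    using s0 unfolding s1 s2 by (simp add: abs_mult flip: right_diff_distrib)
  also have "\<dots> < 4 * e" using p(5) q(5) by linarith
  finally show False by simp
qed

text \<open>Substituting m = p n and exchanging the sums, each m up to x receives a nonzero term
  from at most one p, by \<open>disj\<close>, and that term is at most 1.\<close>

lemma sum_prime_shifts_le:
  fixes G :: "nat \<Rightarrow> real"
  assumes G: "\<And>n. 0 \<le> G n" "\<And>n. G n \<le> 1" and P: "finite P" "\<And>p. p \<in> P \<Longrightarrow> p > 0"
    and disj: "\<And>p q k l. p \<in> P \<Longrightarrow> q \<in> P \<Longrightarrow> p * k = q * l \<Longrightarrow> k > 0 \<Longrightarrow> \<not> p dvd k \<Longrightarrow> \<not> q dvd l \<Longrightarrow>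
            G k \<noteq> 0 \<Longrightarrow> G l \<noteq> 0 \<Longrightarrow> p = q"
    and x: "x > 0"
  shows "(\<Sum>p\<in>P. \<Sum>n\<in>nats_upto (x / real p). if p dvd n then 0 else G n) \<le> x"
proof -
  define F where "F p m = (if p dvd m div p then 0 else G (m div p))" for p m
  have "(\<Sum>p\<in>P. \<Sum>n\<in>nats_upto (x / real p). if p dvd n then 0 else G n)
      = (\<Sum>p\<in>P. \<Sum>m\<in>{m\<in>nats_upto x. p dvd m}. F p m)"
  proof (rule sum.cong)
    fix p assume "p \<in> P"
    then have "p > 0" by (rule P)
    then show "(\<Sum>n\<in>nats_upto (x / real p). if p dvd n then 0 else G n)
        = (\<Sum>m\<in>{m\<in>nats_upto x. p dvd m}. F p m)"
      by (simp add: sum_multiples_nats_upto F_def cong: if_cong)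
  qed simp
  also have "\<dots> = (\<Sum>m\<in>nats_upto x. \<Sum>p\<in>{p\<in>P. p dvd m}. F p m)"
    by (rule sum.swap_restrict) (use P in auto)
  also have "\<dots> \<le> (\<Sum>m\<in>nats_upto x. 1)"
  proof (rule sum_mono)
    fix m assume m: "m \<in> nats_upto x"
    show "(\<Sum>p\<in>{p\<in>P. p dvd m}. F p m) \<le> 1"
    proof (cases "\<exists>p\<in>{p\<in>P. p dvd m}. F p m \<noteq> 0")
      case True
      then obtain p where p: "p \<in> P" "p dvd m" "F p m \<noteq> 0" by auto
      have "F q m = 0" if q: "q \<in> P" "q dvd m" "q \<noteq> p" for q
      proof (rule ccontr)
        assume "F q m \<noteq> 0"
        moreover have "p * (m div p) = q * (m div q)" using p q by simp
        moreover have "m div p > 0"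
          using p m P(2)[of p] by (auto simp: nats_upto_def div_greater_zero_iff dvd_imp_le)
        ultimately show False
          using disj[of p q "m div p" "m div q"] p q by (auto simp: F_def split: if_splits)
      qed
      then have "(\<Sum>p\<in>{p\<in>P. p dvd m}. F p m) = (\<Sum>p\<in>{p}. F p m)"
        using p P by (intro sum.mono_neutral_right) auto
      also have "\<dots> \<le> 1" using G by (simp add: F_def)
      finally show ?thesis .
    next
      case False
      then have "(\<Sum>p\<in>{p\<in>P. p dvd m}. F p m) = 0" by (intro sum.neutral) auto
      then show ?thesis by simp
    qed
  qed
  also have "\<dots> \<le> x" using card_nats_upto_le[of x] x by simp
  finally show ?thesis .
qed

text \<open>Discarding the n divisible by p costs at most x/p^2, hence at most x over all p; with
  the bound x for the rest this gives the constant 2. As P is finite, x may tend to infinity, and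
  the average up to x/p tends to d for each p.\<close>

lemma mean_le_of_prime_shifts_disjoint:
  fixes G :: "nat \<Rightarrow> real"
  assumes G: "\<And>n. 0 \<le> G n" "\<And>n. G n \<le> 1" and lim: "(avg G \<longlongrightarrow> d) at_top"
    and disj: "\<And>p q k l. p \<in> P \<Longrightarrow> q \<in> P \<Longrightarrow> p * k = q * l \<Longrightarrow> k > 0 \<Longrightarrow> \<not> p dvd k \<Longrightarrow> \<not> q dvd l \<Longrightarrow>
            G k \<noteq> 0 \<Longrightarrow> G l \<noteq> 0 \<Longrightarrow> p = q"
    and P: "P = {p. prime p \<and> p \<le> B}"
  shows "d * (\<Sum>p\<in>P. 1 / real p) \<le> 2"
proof -
  have fin: "finite P" and pos: "\<And>p. p \<in> P \<Longrightarrow> p > 0"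
    unfolding P by (auto simp: prime_gt_0_nat)
  have ev: "\<forall>\<^sub>F x in at_top. (\<Sum>p\<in>P. avg G (x / real p) * (1 / real p)) \<le> 2"
    using eventually_gt_at_top[of 0]
  proof eventually_elim
    case (elim x)
    have "(\<Sum>p\<in>P. avg G (x / real p) * (1 / real p)) * x - x
        \<le> (\<Sum>p\<in>P. (avg G (x / real p) * (1 / real p)) * x - x * (1 / (real p)\<^sup>2))"
    proof -
      have "(\<Sum>p\<in>P. 1 / (real p)\<^sup>2) \<le> (\<Sum>p\<in>{1<..B}. 1 / (real p)\<^sup>2)"
        by (intro sum_mono2) (auto simp: P dest: prime_gt_1_nat)
      also have "\<dots> \<le> 1" using sum_inverse_squares_le[of 1 B] by simp
      finally have "x * (\<Sum>p\<in>P. 1 / (real p)\<^sup>2) \<le> x * 1" using elim by (intro mult_left_mono) auto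
      then show ?thesis by (simp add: sum_subtractf sum_distrib_left sum_distrib_right)
    qed
    also have "\<dots> \<le> (\<Sum>p\<in>P. \<Sum>n\<in>nats_upto (x / real p). if p dvd n then 0 else G n)"
    proof (rule sum_mono)
      fix p assume p: "p \<in> P"
      define I where "I = nats_upto (x / real p)"
      have [simp]: "finite I" by (simp add: I_def)
      have "avg G (x / real p) * (1 / real p) * x = (\<Sum>n\<in>I. G n)"
        using elim pos[OF p] by (simp add: avg_def I_def)
      \<comment> \<open>Each n divisible by p is charged the upper bound 1 of G.\<close>
      also have "\<dots> \<le> (\<Sum>n\<in>I. (if p dvd n then 0 else G n) + (if p dvd n then 1 else 0))"
        using G by (intro sum_mono) auto
      also have "\<dots> = (\<Sum>n\<in>I. if p dvd n then 0 else G n) + real (card {n\<in>I. p dvd n})"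
        by (simp add: sum.distrib sum.inter_filter[symmetric])
      also have "real (card {n\<in>I. p dvd n}) \<le> x / real p / real p"
        unfolding I_def using elim pos[OF p] by (intro card_multiples_nats_upto_le) auto
      finally show "avg G (x / real p) * (1 / real p) * x - x * (1 / (real p)\<^sup>2)
          \<le> (\<Sum>n\<in>nats_upto (x / real p). if p dvd n then 0 else G n)"
        by (simp add: I_def power2_eq_square)
    qed
    also have "\<dots> \<le> x" by (rule sum_prime_shifts_le[OF G fin pos disj elim])
    finally have "(\<Sum>p\<in>P. avg G (x / real p) * (1 / real p)) * x \<le> 2 * x" by simp
    then show ?case using elim by simp
  qed
  have "((\<lambda>x. \<Sum>p\<in>P. avg G (x / real p) * (1 / real p)) \<longlongrightarrow> (\<Sum>p\<in>P. d * (1 / real p))) at_top"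
  proof (intro tendsto_sum tendsto_mult tendsto_const)
    fix p assume "p \<in> P"
    then have "filterlim (\<lambda>x. x * inverse (real p)) at_top at_top"
      using pos by (intro filterlim_at_top_mult_tendsto_pos[OF tendsto_const _ filterlim_ident]) auto
    then show "((\<lambda>x. avg G (x / real p)) \<longlongrightarrow> d) at_top"
      using filterlim_compose[OF lim] by (simp add: divide_inverse)
  qed
  then have "(\<Sum>p\<in>P. d * (1 / real p)) \<le> 2"
    by (rule tendsto_upperbound[OF _ ev]) simp
  then show ?thesis by (simp add: sum_distrib_left)
qed

lemma sigma_ratio_concentration_pos:
  assumes u: "u > 0" and \<eta>: "\<eta> > 0"
  shows "\<exists>e>0. \<forall>\<^sub>F x in at_top. avg (\<lambda>n. of_bool (\<bar>sigma_ratio n - u\<bar> \<le> e)) x \<le> (\<eta> :: real)"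
proof -
  \<comment> \<open>Together with \<open>d * S \<le> 2\<close> this brings d below \<eta>/4, within
    the \<eta>/2 that the factor 2 in the last comparison leaves.\<close>
  obtain B where B: "(\<Sum>p | prime p \<and> p \<le> B. 1 / real p) > 8 / \<eta>"
    using prime_reciprocals_unbounded by blast
  define P where "P = {p. prime p \<and> p \<le> B}"
  define S where "S = (\<Sum>p\<in>P. 1 / real p)"
  have "B \<ge> 1"
  proof (rule ccontr)
    assume "\<not> B \<ge> 1"
    then have none: "{p. prime p \<and> p \<le> B} = {}" by (auto simp: not_less_eq_eq)
    show False using B \<eta> unfolding none by simp
  qed
  define e where "e = u / (16 * (real B)\<^sup>2)"
  have e: "e > 0" using u \<open>B \<ge> 1\<close> by (simp add: e_def)
  \<comment> \<open>A tent of half-width \<open>2 * e\<close>: it vanishes outside the window in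
    which the prime shifts are disjoint, and it is at least 1/2 where the distance to u is at most
    \<open>e\<close>, so \<open>2 * g\<close> dominates the indicator.\<close>
  define g where "g t = max 0 (1 - \<bar>t - u\<bar> / (2 * e))" for t :: real
  have g_nz: "\<bar>t - u\<bar> < 2 * e" if "g t \<noteq> 0" for t
    using that e by (auto simp: g_def max_def field_simps split: if_splits)
  have "\<bar>g s - g t\<bar> \<le> 1 / (2 * e) * \<bar>s - t\<bar>" for s t
  proof -
    have "\<bar>g s - g t\<bar> \<le> \<bar>\<bar>s - u\<bar> / (2 * e) - \<bar>t - u\<bar> / (2 * e)\<bar>"
      unfolding g_def by linarith
    also have "\<dots> = \<bar>\<bar>s - u\<bar> - \<bar>t - u\<bar>\<bar> / (2 * e)"
      using e by (simp add: diff_divide_distrib[symmetric])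
    also have "\<dots> \<le> \<bar>s - t\<bar> / (2 * e)" using e by (intro divide_right_mono) auto
    finally show ?thesis by simp
  qed
  then obtain d where d: "(avg (\<lambda>n. g (sigma_ratio n)) \<longlongrightarrow> d) at_top"
    using avg_lipschitz_sigma_ratio_tendsto by blast
  have "d * S \<le> 2"
    unfolding S_def
  proof (rule mean_le_of_prime_shifts_disjoint[OF _ _ d _ P_def])
    show "0 \<le> g (sigma_ratio n)" "g (sigma_ratio n) \<le> 1" for n
      using e by (auto simp: g_def)
    fix p q k l
    assume pq: "p \<in> P" "q \<in> P" and kl: "p * k = q * l" "k > 0" "\<not> p dvd k" "\<not> q dvd l"
      and nz: "g (sigma_ratio k) \<noteq> 0" "g (sigma_ratio l) \<noteq> 0"
    have primes: "prime p" "p \<le> B" "prime q" "q \<le> B" using pq by (auto simp: P_def)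
    have "p * k > 0" using prime_gt_0_nat[OF primes(1)] \<open>k > 0\<close> by simp
    then show "p = q"
      by (rule prime_shifts_disjoint[OF u \<open>B \<ge> 1\<close> e_def primes(1,2) refl kl(3) g_nz[OF nz(1)]
            primes(3,4) kl(1)[symmetric] kl(4) g_nz[OF nz(2)]])
  qed
  moreover have S: "S > 8 / \<eta>" "S > 0"
    using B \<eta> order.strict_trans[of 0 "8 / \<eta>" S] by (auto simp: S_def P_def)
  ultimately have "d \<le> 2 / S" by (simp add: field_simps)
  also have "\<dots> < \<eta> / 2" using S \<eta> by (simp add: field_simps)
  finally have "\<forall>\<^sub>F x in at_top. avg (\<lambda>n. g (sigma_ratio n)) x < \<eta> / 2"
    by (rule order_tendstoD(2)[OF d])
  then have "\<forall>\<^sub>F x in at_top. avg (\<lambda>n. of_bool (\<bar>sigma_ratio n - u\<bar> \<le> e)) x \<le> \<eta>"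
    using eventually_gt_at_top[of 0]
  proof eventually_elim
    case (elim x)
    have "avg (\<lambda>n. of_bool (\<bar>sigma_ratio n - u\<bar> \<le> e)) x \<le> avg (\<lambda>n. 2 * g (sigma_ratio n)) x"
      using e by (intro avg_mono elim) (auto simp: g_def max_def field_simps)
    then show ?case using elim by (simp add: avg_cmult)
  qed
  with e show ?thesis by blast
qed

text \<open>The window of the positive case is proportional to u, so u = 0 is treated by Markov's
  inequality: where n/sigma(n) is at most \<eta>/2, the quantity (\<eta>/2) sigma(n)/n is at least
  1, and its mean is at most \<eta>.\<close>

lemma sigma_ratio_concentration:
  assumes u: "u \<ge> 0" and \<eta>: "\<eta> > 0"
  shows "\<exists>e>0. \<forall>\<^sub>F x in at_top. avg (\<lambda>n. of_bool (\<bar>sigma_ratio n - u\<bar> \<le> e)) x \<le> (\<eta> :: real)"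
proof (cases "u = 0")
  case True
  have "\<forall>\<^sub>F x in at_top. avg (\<lambda>n. of_bool (\<bar>sigma_ratio n - u\<bar> \<le> \<eta> / 2)) x \<le> \<eta>"
    using eventually_gt_at_top[of 0]
  proof eventually_elim
    case (elim x)
    have "avg (\<lambda>n. of_bool (\<bar>sigma_ratio n - u\<bar> \<le> \<eta> / 2)) x
        \<le> avg (\<lambda>n. \<eta> / 2 * (real (divisor_sigma n) / real n)) x"
    proof (rule avg_mono[OF elim])
      fix n :: nat assume n: "n \<ge> 1"
      define a where "a = real (divisor_sigma n) / real n"
      have a: "a > 0" using n divisor_sigma_ge[of n] by (auto simp: a_def)
      show "of_bool (\<bar>sigma_ratio n - u\<bar> \<le> \<eta> / 2) \<le> \<eta> / 2 * (real (divisor_sigma n) / real n)"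
        using a \<eta> True unfolding sigma_ratio_eq a_def[symmetric] by (auto simp: field_simps)
    qed
    also have "\<dots> \<le> \<eta> / 2 * 2"
      unfolding avg_cmult using avg_sigma_le[OF elim] \<eta> by (intro mult_left_mono) auto
    finally show ?case by simp
  qed
  with \<eta> show ?thesis by (intro exI[of _ "\<eta> / 2"]) auto
next
  case False
  with u \<eta> show ?thesis by (intro sigma_ratio_concentration_pos) auto
qed

section \<open>Means of f weighted by functions of n/sigma(n)\<close>

lemma has_mean_value_iff_avg: "has_mean_value g \<longleftrightarrow> (\<exists>L. (avg g \<longlongrightarrow> L) at_top)"
  unfolding has_mean_value_def avg_def[abs_def] nats_upto_def scaleR_conv_of_real ..

lemma D_mean_eq_avg: "D_mean f u = avg (\<lambda>n. f n * of_bool (sigma_ratio n \<le> u))"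
proof
  fix x
  have "(\<Sum>n | 1 \<le> n \<and> real n \<le> x \<and> real n / real (divisor_sigma n) \<le> u. f n)
      = (\<Sum>n\<in>{n\<in>nats_upto x. sigma_ratio n \<le> u}. f n)"
    by (rule sum.cong) (auto simp: nats_upto_def sigma_ratio_def)
  also have "\<dots> = (\<Sum>n\<in>nats_upto x. f n * of_bool (sigma_ratio n \<le> u))"
    by (subst sum.inter_filter, simp, rule sum.cong) simp_all
  finally show "D_mean f u x = avg (\<lambda>n. f n * of_bool (sigma_ratio n \<le> u)) x"
    by (simp add: D_mean_def avg_def scaleR_conv_of_real)
qed

lemma bounded_in_mean_square_avg:
  assumes "bounded_in_mean_square f"
  obtains C where "C > 0" "\<forall>\<^sub>F x in at_top. avg (\<lambda>n. (cmod (f n))\<^sup>2) x \<le> C"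
proof -
  obtain N :: nat where
    "Limsup at_top (\<lambda>x::real. ereal ((1 / x) * (\<Sum>n | 1 \<le> n \<and> real n \<le> x. (cmod (f n))\<^sup>2))) < ereal (real N)"
    using less_PInf_Ex_of_nat[THEN iffD1, OF less_imp_neq, OF assms[unfolded bounded_in_mean_square_def]]
    by blast
  from Limsup_lessD[OF this] have "\<forall>\<^sub>F x in at_top. avg (\<lambda>n. (cmod (f n))\<^sup>2) x \<le> real N + 1"
    by eventually_elim (simp add: avg_def nats_upto_def)
  \<comment> \<open>The added 1 makes C positive even if \<open>N\<close> is 0; C serves as a
    divisor later.\<close>
  then show ?thesis by (intro that[of "real N + 1"]) auto
qed

lemma avg_mult_continuous_tendsto:
  fixes f :: "nat \<Rightarrow> complex" and g :: "real \<Rightarrow> real"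
  assumes C: "C > 0" "\<forall>\<^sub>F x in at_top. avg (\<lambda>n. (cmod (f n))\<^sup>2) x \<le> C"
    and moments: "\<And>k. \<exists>L. (avg (\<lambda>n. f n * of_real (sigma_ratio n ^ k)) \<longlongrightarrow> L) at_top"
    and g: "continuous_on {0..1} g"
  shows "\<exists>L. (avg (\<lambda>n. f n * of_real (g (sigma_ratio n))) \<longlongrightarrow> L) at_top"
proof (rule tendsto_exists_approx)
  fix e :: real assume e: "e > 0"
  \<comment> \<open>Since |f| is at most 1 + |f|^2, whose mean is eventually at most 1 + C, a
    uniform error \<open>e'\<close> in the polynomial costs at most \<open>e\<close> in
    mean.\<close>
  define e' where "e' = e / (1 + C)"
  have e': "e' > 0" using e C by (simp add: e'_def)
  obtain p where p: "real_polynomial_function p" "\<And>t. t \<in> {0..1} \<Longrightarrow> \<bar>g t - p t\<bar> < e'"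
    using Stone_Weierstrass_real_polynomial_function[OF compact_Icc g e'] by blast
  obtain a N where a: "p = (\<lambda>t. \<Sum>i\<le>(N::nat). a i * t ^ i)"
    using real_polynomial_function_imp_sum[OF p(1)] by blast
  obtain M where M: "\<And>k. (avg (\<lambda>n. f n * of_real (sigma_ratio n ^ k)) \<longlongrightarrow> M k) at_top"
    using moments by metis
  have "avg (\<lambda>n. f n * of_real (p (sigma_ratio n)))
      = (\<lambda>x. \<Sum>i\<le>N. of_real (a i) * avg (\<lambda>n. f n * of_real (sigma_ratio n ^ i)) x)"
  proof
    fix x
    have "(\<Sum>n\<in>nats_upto x. f n * of_real (p (sigma_ratio n)))
        = (\<Sum>n\<in>nats_upto x. \<Sum>i\<le>N. of_real (a i) * (f n * of_real (sigma_ratio n ^ i)))"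
      by (simp add: a sum_distrib_left mult_ac)
    also have "\<dots> = (\<Sum>i\<le>N. of_real (a i) * (\<Sum>n\<in>nats_upto x. f n * of_real (sigma_ratio n ^ i)))"
      by (subst sum.swap) (simp add: sum_distrib_left)
    finally show "avg (\<lambda>n. f n * of_real (p (sigma_ratio n))) x
        = (\<Sum>i\<le>N. of_real (a i) * avg (\<lambda>n. f n * of_real (sigma_ratio n ^ i)) x)"
      by (simp add: avg_def scaleR_conv_of_real sum_distrib_left mult_ac)
  qed
  then have lim: "(avg (\<lambda>n. f n * of_real (p (sigma_ratio n))) \<longlongrightarrow> (\<Sum>i\<le>N. of_real (a i) * M i)) at_top"
    by (simp only:) (intro tendsto_intros M)
  have "\<forall>\<^sub>F x in at_top. norm (avg (\<lambda>n. f n * of_real (g (sigma_ratio n))) x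
      - avg (\<lambda>n. f n * of_real (p (sigma_ratio n))) x) \<le> e"
    using eventually_gt_at_top[of 0] C(2)
  proof eventually_elim
    case (elim x)
    have "norm (avg (\<lambda>n. f n * of_real (g (sigma_ratio n))) x - avg (\<lambda>n. f n * of_real (p (sigma_ratio n))) x)
        \<le> avg (\<lambda>n. norm (f n * of_real (g (sigma_ratio n)) - f n * of_real (p (sigma_ratio n)))) x"
      unfolding avg_diff[symmetric] by (rule norm_avg_le[OF elim(1)])
    also have "\<dots> \<le> avg (\<lambda>n. e' * (1 + (cmod (f n))\<^sup>2)) x"
    proof (rule avg_mono[OF elim(1)])
      fix n :: nat assume n: "n \<ge> 1"
      have "norm (f n * of_real (g (sigma_ratio n)) - f n * of_real (p (sigma_ratio n)))
          = \<bar>g (sigma_ratio n) - p (sigma_ratio n)\<bar> * cmod (f n)"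
        by (simp add: norm_mult mult.commute flip: right_diff_distrib of_real_diff)
      also have "\<dots> \<le> e' * (1 + (cmod (f n))\<^sup>2)"
      proof (rule mult_mono)
        show "\<bar>g (sigma_ratio n) - p (sigma_ratio n)\<bar> \<le> e'"
          using p(2)[of "sigma_ratio n"] sigma_ratio_bounds[of n] n by auto
        show "cmod (f n) \<le> 1 + (cmod (f n))\<^sup>2"
          using sum_squares_bound[of "cmod (f n)" 1] norm_ge_zero[of "f n"]
          unfolding power_one mult_1_right by linarith
      qed (use e' in auto)
      finally show "norm (f n * of_real (g (sigma_ratio n)) - f n * of_real (p (sigma_ratio n)))
          \<le> e' * (1 + (cmod (f n))\<^sup>2)" .
    qed
    also have "\<dots> \<le> e' * (1 + C)"
      unfolding avg_cmult avg_add using elim avg_const_le[of x 1] e'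
      by (intro mult_left_mono add_mono) auto
    also have "\<dots> = e" using C by (simp add: e'_def)
    finally show ?case .
  qed
  with lim show "\<exists>G L. (G \<longlongrightarrow> L) at_top \<and>
      (\<forall>\<^sub>F x in at_top. norm (avg (\<lambda>n. f n * of_real (g (sigma_ratio n))) x - G x) \<le> e)"
    by blast
qed

text \<open>This converts small density near u into a small contribution of |f| there, and it drives
  both the existence of the limit and its continuity in u.\<close>

lemma avg_norm_concentration:
  fixes f :: "nat \<Rightarrow> complex"
  assumes C: "C > 0" "\<forall>\<^sub>F x in at_top. avg (\<lambda>n. (cmod (f n))\<^sup>2) x \<le> C"
    and "u \<ge> 0" "e > 0"
  shows "\<exists>\<delta>>0. \<forall>\<^sub>F x in at_top. avg (\<lambda>n. cmod (f n) * of_bool (\<bar>sigma_ratio n - u\<bar> \<le> \<delta>)) x \<le> e"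
proof -
  \<comment> \<open>The pointwise bound c |f|^2 + 1/c on the window has two parts: this
    \<open>c\<close> makes the first at most e/2 in mean, and the density bound
    \<open>e * c / 2\<close> does the same for the second.\<close>
  define c where "c = e / (2 * C)"
  have c: "c > 0" using assms by (simp add: c_def)
  obtain \<delta> where \<delta>: "\<delta> > 0"
    "\<forall>\<^sub>F x in at_top. avg (\<lambda>n. of_bool (\<bar>sigma_ratio n - u\<bar> \<le> \<delta>)) x \<le> e * c / 2"
    using sigma_ratio_concentration[of u "e * c / 2"] assms c by auto
  have "\<forall>\<^sub>F x in at_top. avg (\<lambda>n. cmod (f n) * of_bool (\<bar>sigma_ratio n - u\<bar> \<le> \<delta>)) x \<le> e"
    using eventually_gt_at_top[of 0] C(2) \<delta>(2)
  proof eventually_elim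
    case (elim x)
    have "avg (\<lambda>n. cmod (f n) * of_bool (\<bar>sigma_ratio n - u\<bar> \<le> \<delta>)) x
       \<le> avg (\<lambda>n. c * (cmod (f n))\<^sup>2 + 1 / c * of_bool (\<bar>sigma_ratio n - u\<bar> \<le> \<delta>)) x"
    proof (rule avg_mono[OF elim(1)])
      fix n
      define y where "y = cmod (f n)"
      \<comment> \<open>AM-GM in place of Cauchy-Schwarz\<close>
      have "0 \<le> (c * y - 1)\<^sup>2" "0 \<le> c * y" using c by (auto simp: y_def)
      then have "y * c \<le> c * c * y\<^sup>2 + 1" by (simp add: power2_eq_square algebra_simps)
      then have "y \<le> c * y\<^sup>2 + 1 / c" using c by (simp add: field_simps power2_eq_square)
      then show "cmod (f n) * of_bool (\<bar>sigma_ratio n - u\<bar> \<le> \<delta>)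
          \<le> c * (cmod (f n))\<^sup>2 + 1 / c * of_bool (\<bar>sigma_ratio n - u\<bar> \<le> \<delta>)"
        using c by (auto simp: y_def)
    qed
    also have "\<dots> \<le> c * C + 1 / c * (e * c / 2)"
      unfolding avg_add avg_cmult using elim c by (intro add_mono mult_left_mono) auto
    also have "\<dots> = e" using c C by (simp add: c_def)
    finally show ?case .
  qed
  with \<delta>(1) show ?thesis by blast
qed

theorem theorem1p1:
  fixes f :: "nat \<Rightarrow> complex"
  assumes "multiplicative f"
    and "bounded_in_mean_square f"
    and "\<And>k::nat. has_mean_value (\<lambda>n. f n * complex_of_real ((real n / real (divisor_sigma n)) ^ k))"
  shows "(\<forall>u\<in>{0..1}. \<exists>L. (D_mean f u \<longlongrightarrow> L) at_top) \<and> continuous_on {0..1} (D f)"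
proof -
  obtain C where C: "C > 0" "\<forall>\<^sub>F x in at_top. avg (\<lambda>n. (cmod (f n))\<^sup>2) x \<le> C"
    using bounded_in_mean_square_avg[OF assms(2)] .
  have moments: "\<exists>L. (avg (\<lambda>n. f n * of_real (sigma_ratio n ^ k)) \<longlongrightarrow> L) at_top" for k
    using assms(3)[of k] unfolding has_mean_value_iff_avg sigma_ratio_def .
  have ex: "\<exists>L. (D_mean f u \<longlongrightarrow> L) at_top" if u: "u \<in> {0..1}" for u
    unfolding D_mean_eq_avg
  proof (rule tendsto_exists_approx)
    fix e :: real assume "e > 0"
    then obtain \<delta> where \<delta>: "\<delta> > 0"
      "\<forall>\<^sub>F x in at_top. avg (\<lambda>n. cmod (f n) * of_bool (\<bar>sigma_ratio n - u\<bar> \<le> \<delta>)) x \<le> e"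
      using avg_norm_concentration[OF C, of u e] u by auto
    \<comment> \<open>A continuous cutoff: 1 up to u, linear on the next stretch of length \<delta>,
      then 0. It departs from the indicator only within \<delta> of u.\<close>
    define g where "g t = max 0 (min 1 (1 - (t - u) / \<delta>))" for t
    have "continuous_on {0..1} g" unfolding g_def by (intro continuous_intros) (use \<delta> in auto)
    then obtain L where L: "(avg (\<lambda>n. f n * of_real (g (sigma_ratio n))) \<longlongrightarrow> L) at_top"
      using avg_mult_continuous_tendsto[OF C moments] by blast
    have g: "\<bar>of_bool (t \<le> u) - g t\<bar> \<le> of_bool (\<bar>t - u\<bar> \<le> \<delta>)" for t
    proof -
      consider "t \<le> u" | "u < t" "t - u \<le> \<delta>" | "t - u > \<delta>" by linarith
      then show ?thesis
      proof cases
        case 1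
        then have "(t - u) / \<delta> \<le> 0" using \<delta> by (simp add: divide_nonpos_pos)
        then show ?thesis using 1 by (simp add: g_def)
      next
        case 2
        then show ?thesis using \<delta> by (auto simp: g_def)
      next
        case 3
        then have "(t - u) / \<delta> > 1" using \<delta> by simp
        then show ?thesis using 3 \<delta> by (simp add: g_def)
      qed
    qed
    have "\<forall>\<^sub>F x in at_top. norm (avg (\<lambda>n. f n * of_bool (sigma_ratio n \<le> u)) x
        - avg (\<lambda>n. f n * of_real (g (sigma_ratio n))) x) \<le> e"
      using eventually_gt_at_top[of 0] \<delta>(2)
    proof eventually_elim
      case (elim x)
      have "norm (avg (\<lambda>n. f n * of_bool (sigma_ratio n \<le> u)) x
          - avg (\<lambda>n. f n * of_real (g (sigma_ratio n))) x)
        \<le> avg (\<lambda>n. norm (f n * of_bool (sigma_ratio n \<le> u) - f n * of_real (g (sigma_ratio n)))) x"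
        unfolding avg_diff[symmetric] by (rule norm_avg_le[OF elim(1)])
      also have "\<dots> \<le> avg (\<lambda>n. cmod (f n) * of_bool (\<bar>sigma_ratio n - u\<bar> \<le> \<delta>)) x"
      proof (rule avg_mono[OF elim(1)])
        fix n
        have "f n * of_bool (sigma_ratio n \<le> u) - f n * of_real (g (sigma_ratio n))
            = f n * of_real (of_bool (sigma_ratio n \<le> u) - g (sigma_ratio n))"
          by (simp add: algebra_simps)
        then show "norm (f n * of_bool (sigma_ratio n \<le> u) - f n * of_real (g (sigma_ratio n)))
            \<le> cmod (f n) * of_bool (\<bar>sigma_ratio n - u\<bar> \<le> \<delta>)"
          using g[of "sigma_ratio n"] by (simp only: norm_mult norm_of_real) (intro mult_left_mono, auto)
      qed
      finally show ?case using elim(2) by linarith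
    qed
    with L show "\<exists>G L. (G \<longlongrightarrow> L) at_top \<and>
        (\<forall>\<^sub>F x in at_top. norm (avg (\<lambda>n. f n * of_bool (sigma_ratio n \<le> u)) x - G x) \<le> e)"
      by blast
  qed
  \<comment> \<open>Existence of the limit, from \<open>ex\<close>, is what lets the
    \<open>Lim\<close> in \<open>D\<close> denote it.\<close>
  have D: "(D_mean f u \<longlongrightarrow> D f u) at_top" if "u \<in> {0..1}" for u
    using ex[OF that] tendsto_Lim[OF trivial_limit_at_top_linorder] unfolding D_def by blast
  have "continuous_on {0..1} (D f)"
    unfolding continuous_on_iff
  proof (intro ballI allI impI)
    fix u e :: real assume u: "u \<in> {0..1}" and e: "e > 0"
    then obtain \<delta> where \<delta>: "\<delta> > 0"
      "\<forall>\<^sub>F x in at_top. avg (\<lambda>n. cmod (f n) * of_bool (\<bar>sigma_ratio n - u\<bar> \<le> \<delta>)) x \<le> e / 2"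
      using avg_norm_concentration[OF C, of u "e / 2"] by auto
    \<comment> \<open>The two cutoffs disagree only at ratios between u and v, all within \<delta>
      of u, so one \<delta> serves every such v. The bound e/2 survives the limit in x and leaves
      room for the strict inequality.\<close>
    have "dist (D f v) (D f u) < e" if v: "v \<in> {0..1}" "dist v u < \<delta>" for v
    proof -
      have "\<forall>\<^sub>F x in at_top. norm (D_mean f v x - D_mean f u x) \<le> e / 2"
        using eventually_gt_at_top[of 0] \<delta>(2)
      proof eventually_elim
        case (elim x)
        have "norm (D_mean f v x - D_mean f u x)
            \<le> avg (\<lambda>n. norm (f n * of_bool (sigma_ratio n \<le> v) - f n * of_bool (sigma_ratio n \<le> u))) x"
          unfolding D_mean_eq_avg avg_diff[symmetric] by (rule norm_avg_le[OF elim(1)])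
        also have "\<dots> \<le> avg (\<lambda>n. cmod (f n) * of_bool (\<bar>sigma_ratio n - u\<bar> \<le> \<delta>)) x"
          using v(2) by (intro avg_mono elim) (auto simp: dist_real_def of_bool_def)
        finally show ?case using elim(2) by linarith
      qed
      then have "norm (D f v - D f u) \<le> e / 2"
        by (rule tendsto_upperbound[OF tendsto_norm[OF tendsto_diff[OF D[OF v(1)] D[OF u]]]]) simp
      then show ?thesis using e by (simp add: dist_norm)
    qed
    then show "\<exists>d>0. \<forall>v\<in>{0..1}. dist v u < d \<longrightarrow> dist (D f v) (D f u) < e"
      using \<delta>(1) by blast
  qed
  with ex show ?thesis by blast
qed

end
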